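(* Let $\mathcal{K}$ be a Kreĭn space, regularly irreducible under the fundamental action of a group $G$ of unitary operators. Let $A$ be a bounded operator on $\mathcal{K}$ and suppose that $TA=AT$ for all $T\in G$. Then $A=\lambda I$ for some scalar $\lambda$.
   Context: A Kreĭn space is a complex vector space $\mathcal{K}$ with a Hermitian sesquilinear form $[\cdot,\cdot]$ admitting a fundamental symmetry $J$ ($J^2=I$, $\langle x,y\rangle=[Jx,y]$ a Hilbert inner product); its topology is that of any such Hilbert norm. Unitarity, adjoints $A^{[*]}$ and positivity ($[Ax,x]\ge0$) are with respect to $[\cdot,\cdot]$. The action of $G$ is fundamental if $G$ contains a fundamental symmetry: there is $g\in G$ with $g=g^{[*]}=g^{-1}$ and $g$ positive. A subspace is regular if it is closed and a Kreĭn space for the restricted form. $\mathcal{K}$ is regularly irreducible under $G$ if it has no $G$-invariant regular subspace other than $0$ and $\mathcal{K}$. *)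

theory Defs
  imports "HOL-Analysis.Analysis" "HOL-Algebra.Group"
begin

text \<open>
  The complex vector space is a type \<open>'k\<close> with a scalar multiplication \<open>smul\<close>
  satisfying the locale predicate \<^locale>\<open>vector_space\<close>.  Forms and inner products are considered
  relative to a subspace \<open>V\<close>, so that the same notions apply to the whole space (\<open>V = UNIV\<close>)
  and to the restriction of the form to a subspace.  Forms are linear in the first argument.
\<close>

definition hermitian_form_on ::
  "(complex \<Rightarrow> 'k \<Rightarrow> 'k) \<Rightarrow> 'k::ab_group_add set \<Rightarrow> ('k \<Rightarrow> 'k \<Rightarrow> complex) \<Rightarrow> bool" where
  "hermitian_form_on smul V f \<longleftrightarrow>
     (\<forall>x\<in>V. \<forall>y\<in>V. \<forall>z\<in>V. f (x + y) z = f x z + f y z) \<and>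
     (\<forall>c. \<forall>x\<in>V. \<forall>y\<in>V. f (smul c x) y = c * f x y) \<and>
     (\<forall>x\<in>V. \<forall>y\<in>V. f y x = cnj (f x y))"

text \<open>
  The value \<open>0\<close> off \<open>V\<close> is a dummy: \<^locale>\<open>Metric_space\<close> requires distances to be nonnegative
  and symmetric on the whole type.
\<close>

definition ip_dist :: "'k::ab_group_add set \<Rightarrow> ('k \<Rightarrow> 'k \<Rightarrow> complex) \<Rightarrow> 'k \<Rightarrow> 'k \<Rightarrow> real" where
  "ip_dist V ip x y = (if x \<in> V \<and> y \<in> V then sqrt (Re (ip (x - y) (x - y))) else 0)"

definition inner_product_on ::
  "(complex \<Rightarrow> 'k \<Rightarrow> 'k) \<Rightarrow> 'k::ab_group_add set \<Rightarrow> ('k \<Rightarrow> 'k \<Rightarrow> complex) \<Rightarrow> bool" where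
  "inner_product_on smul V ip \<longleftrightarrow>
     hermitian_form_on smul V ip \<and> (\<forall>x\<in>V. x \<noteq> 0 \<longrightarrow> 0 < Re (ip x x))"

lemma inner_product_on_cauchy_schwarz:
  assumes vs: "vector_space smul" and sub: "module.subspace smul V"
    and ip: "inner_product_on smul V ip" and x: "x \<in> V" and y: "y \<in> V"
  shows "Re (ip x y) \<le> sqrt (Re (ip x x)) * sqrt (Re (ip y y))"
proof -
  interpret vector_space smul by (rule vs)
  have add: "ip (u + v) w = ip u w + ip v w" if "u \<in> V" "v \<in> V" "w \<in> V" for u v w
    using ip that unfolding inner_product_on_def hermitian_form_on_def by blast
  have sc: "ip (smul c u) v = c * ip u v" if "u \<in> V" "v \<in> V" for c u v
    using ip that unfolding inner_product_on_def hermitian_form_on_def by blast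
  have cj: "ip v u = cnj (ip u v)" if "u \<in> V" "v \<in> V" for u v
    using ip that unfolding inner_product_on_def hermitian_form_on_def by blast
  have pos: "0 < Re (ip u u)" if "u \<in> V" "u \<noteq> 0" for u
    using ip that unfolding inner_product_on_def by blast
  have zero: "0 \<in> V" using sub by (rule subspace_0)
  have zl: "ip 0 v = 0" if "v \<in> V" for v
    using sc[of 0 v 0] that zero by simp
  have zr: "ip v 0 = 0" if "v \<in> V" for v
    using zl[OF that] cj[OF zero that] by simp
  show ?thesis
  proof (cases "x = 0 \<or> y = 0")
    case True
    then show ?thesis using zl zr x y zero by auto
  next
    case False
    define a where "a = sqrt (Re (ip x x))"
    define b where "b = sqrt (Re (ip y y))"
    have ab: "a > 0" "b > 0" using pos x y False by (auto simp: a_def b_def)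
    have a2: "Re (ip x x) = a * a" and b2: "Re (ip y y) = b * b"
      using pos x y False by (auto simp: a_def b_def less_imp_le)
    define u where "u = smul (of_real b) x"
    define v where "v = smul (of_real (- a)) y"
    have u: "u \<in> V" and v: "v \<in> V"
      unfolding u_def v_def by (rule subspace_scale[OF sub x], rule subspace_scale[OF sub y])
    have uv: "u \<in> V" "v \<in> V" "u + v \<in> V"
      using u v subspace_add[OF sub u v] by auto
    have r: "ip w (p + q) = ip w p + ip w q" if "w \<in> V" "p \<in> V" "q \<in> V" "p + q \<in> V" for w p q
      using cj[OF that(4,1)] cj[OF that(2,1)] cj[OF that(3,1)] add[OF that(2,3,1)] by simp
    have sr: "ip w (smul c p) = cnj c * ip w p" if "w \<in> V" "p \<in> V" for w c p
      using cj[OF subspace_scale[OF sub that(2)] that(1), of c] cj[OF that(2,1)] sc[OF that(2,1)]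
      by simp
    have sm: "ip (smul (of_real c) p) (smul (of_real d) q) = of_real (c * d) * ip p q"
      if "p \<in> V" "q \<in> V" for c d p q
      using sc[OF that(1) subspace_scale[OF sub that(2)], of "of_real c" "of_real d"]
        sr[OF that, of "of_real d"] by simp
    have "Re (ip (u + v) (u + v)) \<ge> 0"
      using pos[OF uv(3)] zl[OF zero] by (cases "u + v = 0") auto
    moreover have "ip (u + v) (u + v) = ip u u + ip u v + ip v u + ip v v"
      using add[OF uv(1,2,3)] r[OF uv(1) uv(1,2,3)] r[OF uv(2) uv(1,2,3)] by simp
    moreover have "ip u u = of_real (b * b) * ip x x" "ip v v = of_real (a * a) * ip y y"
      "ip u v = of_real (- a * b) * ip x y" "ip v u = of_real (- a * b) * ip y x"
      using sm[OF x x, of b b] sm[OF y y, of "- a" "- a"] sm[OF x y, of b "- a"]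
        sm[OF y x, of "- a" b] by (simp_all add: u_def v_def mult.commute)
    moreover have "Re (ip y x) = Re (ip x y)" using cj[OF x y] by simp
    ultimately have "0 \<le> (2 * (a * b)) * (a * b - Re (ip x y))"
      by (simp add: a2 b2 algebra_simps)
    then have "0 \<le> a * b - Re (ip x y)"
      using mult_pos_pos[OF ab] by (smt (verit) mult_pos_neg)
    then show ?thesis by (simp add: a_def b_def)
  qed
qed

lemma Metric_space_ip_dist:
  assumes vs: "vector_space smul" and sub: "module.subspace smul V"
    and ip: "inner_product_on smul V ip"
  shows "Metric_space V (ip_dist V ip)"
proof -
  interpret vector_space smul by (rule vs)
  have add: "ip (u + v) w = ip u w + ip v w" if "u \<in> V" "v \<in> V" "w \<in> V" for u v w
    using ip that unfolding inner_product_on_def hermitian_form_on_def by blast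
  have sc: "ip (smul c u) v = c * ip u v" if "u \<in> V" "v \<in> V" for c u v
    using ip that unfolding inner_product_on_def hermitian_form_on_def by blast
  have cj: "ip v u = cnj (ip u v)" if "u \<in> V" "v \<in> V" for u v
    using ip that unfolding inner_product_on_def hermitian_form_on_def by blast
  have pos: "0 < Re (ip u u)" if "u \<in> V" "u \<noteq> 0" for u
    using ip that unfolding inner_product_on_def by blast
  have zero: "0 \<in> V" using sub by (rule subspace_0)
  have z: "ip 0 0 = 0" using sc[of 0 0 0] zero by simp
  have nn: "0 \<le> Re (ip u u)" if "u \<in> V" for u
    using pos[OF that] z by (cases "u = 0") auto
  have diff: "u - v \<in> V" if "u \<in> V" "v \<in> V" for u v
    using that sub by (rule subspace_diff[rotated])
  have neg: "ip (- u) (- u) = ip u u" if "u \<in> V" for u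
  proof -
    have m: "- u = smul (- 1) u" by simp
    have mV: "smul (- 1) u \<in> V" using sub that by (rule subspace_scale)
    show ?thesis
      unfolding m using sc[OF that mV, of "- 1"] cj[OF mV that] sc[OF that that, of "- 1"]
        cj[OF that that] by simp
  qed
  have tri: "sqrt (Re (ip (u + v) (u + v))) \<le> sqrt (Re (ip u u)) + sqrt (Re (ip v v))"
    if u: "u \<in> V" and v: "v \<in> V" for u v
  proof -
    have w: "u + v \<in> V" using sub u v by (rule subspace_add)
    have r: "ip p (u + v) = ip p u + ip p v" if "p \<in> V" for p
      using cj[OF w that] cj[OF u that] cj[OF v that] add[OF u v that] by simp
    have "Re (ip (u + v) (u + v)) = Re (ip u u) + 2 * Re (ip u v) + Re (ip v v)"
      using add[OF u v w] r[OF u] r[OF v] cj[OF u v] by simp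
    also have "\<dots> \<le> (sqrt (Re (ip u u)) + sqrt (Re (ip v v)))\<^sup>2"
      using inner_product_on_cauchy_schwarz[OF vs sub ip u v] nn[OF u] nn[OF v]
      by (simp add: power2_sum)
    finally show ?thesis
      using nn[OF u] nn[OF v] by (intro real_le_lsqrt) auto
  qed
  show ?thesis
  proof
    show "0 \<le> ip_dist V ip x y" for x y
      using nn diff by (auto simp: ip_dist_def)
    show "ip_dist V ip x y = ip_dist V ip y x" for x y
      using neg[OF diff, of x y] by (auto simp: ip_dist_def)
    show "ip_dist V ip x y = 0 \<longleftrightarrow> x = y" if "x \<in> V" "y \<in> V" for x y
      using pos[OF diff, OF that] that z by (cases "x = y") (auto simp: ip_dist_def)
    show "ip_dist V ip x w \<le> ip_dist V ip x y + ip_dist V ip y w"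
      if "x \<in> V" "y \<in> V" "w \<in> V" for x y w
      using tri[OF diff diff, of x y y w] that by (simp add: ip_dist_def)
  qed
qed

definition hilbert_inner_product_on ::
  "(complex \<Rightarrow> 'k \<Rightarrow> 'k) \<Rightarrow> 'k::ab_group_add set \<Rightarrow> ('k \<Rightarrow> 'k \<Rightarrow> complex) \<Rightarrow> bool" where
  "hilbert_inner_product_on smul V ip \<longleftrightarrow>
     inner_product_on smul V ip \<and> Metric_space.mcomplete V (ip_dist V ip)"

definition fundamental_symmetry_on ::
  "(complex \<Rightarrow> 'k \<Rightarrow> 'k) \<Rightarrow> 'k::ab_group_add set \<Rightarrow> ('k \<Rightarrow> 'k \<Rightarrow> complex) \<Rightarrow> ('k \<Rightarrow> 'k) \<Rightarrow> bool" where
  "fundamental_symmetry_on smul V f J \<longleftrightarrow>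
     (\<forall>x\<in>V. J x \<in> V) \<and>
     (\<forall>x\<in>V. \<forall>y\<in>V. J (x + y) = J x + J y) \<and>
     (\<forall>c. \<forall>x\<in>V. J (smul c x) = smul c (J x)) \<and>
     (\<forall>x\<in>V. J (J x) = x) \<and>
     hilbert_inner_product_on smul V (\<lambda>x y. f (J x) y)"

definition krein_space_on ::
  "(complex \<Rightarrow> 'k \<Rightarrow> 'k) \<Rightarrow> 'k::ab_group_add set \<Rightarrow> ('k \<Rightarrow> 'k \<Rightarrow> complex) \<Rightarrow> bool" where
  "krein_space_on smul V f \<longleftrightarrow>
     vector_space smul \<and> module.subspace smul V \<and> hermitian_form_on smul V f \<and>
     (\<exists>J. fundamental_symmetry_on smul V f J)"

abbreviation krein_space ::
  "(complex \<Rightarrow> 'k \<Rightarrow> 'k) \<Rightarrow> ('k::ab_group_add \<Rightarrow> 'k \<Rightarrow> complex) \<Rightarrow> bool" where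
  "krein_space smul f \<equiv> krein_space_on smul UNIV f"

text \<open>
  All fundamental symmetries of a Krein space induce equivalent Hilbert norms, so neither the
  topology nor boundedness of operators depends on the one chosen here.
\<close>

definition krein_ip ::
  "(complex \<Rightarrow> 'k \<Rightarrow> 'k) \<Rightarrow> ('k::ab_group_add \<Rightarrow> 'k \<Rightarrow> complex) \<Rightarrow> 'k \<Rightarrow> 'k \<Rightarrow> complex" where
  "krein_ip smul f x y = f ((SOME J. fundamental_symmetry_on smul UNIV f J) x) y"

definition krein_norm ::
  "(complex \<Rightarrow> 'k \<Rightarrow> 'k) \<Rightarrow> ('k::ab_group_add \<Rightarrow> 'k \<Rightarrow> complex) \<Rightarrow> 'k \<Rightarrow> real" where
  "krein_norm smul f x = sqrt (Re (krein_ip smul f x x))"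

definition krein_topology ::
  "(complex \<Rightarrow> 'k \<Rightarrow> 'k) \<Rightarrow> ('k::ab_group_add \<Rightarrow> 'k \<Rightarrow> complex) \<Rightarrow> 'k topology" where
  "krein_topology smul f = Metric_space.mtopology UNIV (ip_dist UNIV (krein_ip smul f))"

definition bounded_operator ::
  "(complex \<Rightarrow> 'k \<Rightarrow> 'k) \<Rightarrow> ('k::ab_group_add \<Rightarrow> 'k \<Rightarrow> complex) \<Rightarrow> ('k \<Rightarrow> 'k) \<Rightarrow> bool" where
  "bounded_operator smul f A \<longleftrightarrow>
     Vector_Spaces.linear smul smul A \<and>
     (\<exists>C. \<forall>x. krein_norm smul f (A x) \<le> C * krein_norm smul f x)"

text \<open>\<open>krein_adjoint f A A'\<close> says that \<open>A'\<close> is the (unique, by nondegeneracy) adjoint of \<open>A\<close>.\<close>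

definition krein_adjoint ::
  "('k \<Rightarrow> 'k \<Rightarrow> complex) \<Rightarrow> ('k \<Rightarrow> 'k) \<Rightarrow> ('k \<Rightarrow> 'k) \<Rightarrow> bool" where
  "krein_adjoint f A A' \<longleftrightarrow> (\<forall>x y. f (A x) y = f x (A' y))"

definition krein_unitary ::
  "(complex \<Rightarrow> 'k \<Rightarrow> 'k) \<Rightarrow> ('k::ab_group_add \<Rightarrow> 'k \<Rightarrow> complex) \<Rightarrow> ('k \<Rightarrow> 'k) \<Rightarrow> bool" where
  "krein_unitary smul f U \<longleftrightarrow>
     bounded_operator smul f U \<and> bij U \<and> krein_adjoint f U (inv_into UNIV U)"

definition krein_positive :: "('k \<Rightarrow> 'k \<Rightarrow> complex) \<Rightarrow> ('k \<Rightarrow> 'k) \<Rightarrow> bool" where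
  "krein_positive f A \<longleftrightarrow> (\<forall>x. f (A x) x \<in> \<real>\<^sub>\<ge>\<^sub>0)"

definition unitary_operator_group ::
  "(complex \<Rightarrow> 'k \<Rightarrow> 'k) \<Rightarrow> ('k::ab_group_add \<Rightarrow> 'k \<Rightarrow> complex) \<Rightarrow> ('k \<Rightarrow> 'k) set \<Rightarrow> bool" where
  "unitary_operator_group smul f G \<longleftrightarrow>
     (\<forall>U\<in>G. krein_unitary smul f U) \<and>
     group \<lparr>carrier = G, monoid.mult = (\<circ>), one = id\<rparr>"

definition fundamental_action ::
  "('k \<Rightarrow> 'k \<Rightarrow> complex) \<Rightarrow> ('k \<Rightarrow> 'k) set \<Rightarrow> bool" where
  "fundamental_action f G \<longleftrightarrow>
     (\<exists>g\<in>G. krein_adjoint f g g \<and> g \<circ> g = id \<and> krein_positive f g)"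

definition regular_subspace ::
  "(complex \<Rightarrow> 'k \<Rightarrow> 'k) \<Rightarrow> ('k::ab_group_add \<Rightarrow> 'k \<Rightarrow> complex) \<Rightarrow> 'k set \<Rightarrow> bool" where
  "regular_subspace smul f S \<longleftrightarrow>
     module.subspace smul S \<and> closedin (krein_topology smul f) S \<and> krein_space_on smul S f"

definition regularly_irreducible ::
  "(complex \<Rightarrow> 'k \<Rightarrow> 'k) \<Rightarrow> ('k::ab_group_add \<Rightarrow> 'k \<Rightarrow> complex) \<Rightarrow> ('k \<Rightarrow> 'k) set \<Rightarrow> bool" where
  "regularly_irreducible smul f G \<longleftrightarrow>
     (\<forall>S. regular_subspace smul f S \<and> (\<forall>T\<in>G. T ` S \<subseteq> S) \<longrightarrow> S = {0} \<or> S = UNIV)"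

end

theory Submission
  imports Defs
begin

text \<open>
  The fundamental symmetry \<open>g \<in> G\<close> defines a Hilbert inner product \<open>[g x, y]\<close> inducing the topology
  of the space.  An operator commuting with \<open>G\<close> commutes with \<open>g\<close>, so \<open>g\<close> restricts to a fundamental
  symmetry of its kernel; the kernel is thus a regular invariant subspace and hence trivial.  Moreover
  \<open>G\<close> is closed under Hilbert adjoints, so the commutant is too, and it suffices to treat Hilbert
  self-adjoint operators \<open>B\<close>.  With \<open>\<bar>B\<bar>\<close> the positive square root of \<open>B\<^sup>2\<close>, the identity
  \<open>(\<bar>B\<bar> - B) (\<bar>B\<bar> + B) = 0\<close> and the triviality of \<open>ker (\<bar>B\<bar> - B)\<close> give \<open>B \<ge> 0\<close> or \<open>B \<le> 0\<close>.  Applied to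
  \<open>B - t\<close> for every real \<open>t\<close>, this forces \<open>B\<close> to be a scalar.
\<close>

section \<open>Bounded operators and adjoints\<close>

text \<open>If \<open>q\<close> were nonzero, a small \<open>t\<close> of the opposite sign would
  let the linear term outweigh the quadratic one. This is the first-order condition at a minimum,
  used for Riesz representation.\<close>

lemma linear_nonneg_imp_zero:
  fixes p q :: real
  assumes "\<And>t. 0 \<le> t\<^sup>2 * p + 2 * t * q"
  shows "q = 0"
proof (rule ccontr)
  assume q: "q \<noteq> 0"
  define t where "t = - q / (\<bar>p\<bar> + 1)"
  have t: "t * (\<bar>p\<bar> + 1) = - q" by (simp add: t_def)
  have "t\<^sup>2 * p \<le> t\<^sup>2 * (\<bar>p\<bar> + 1)" by (intro mult_left_mono) auto
  also have "\<dots> = - t * q" using t by (simp add: power2_eq_square mult.assoc)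
  finally have "0 \<le> t * q" using assms[of t] by simp
  moreover have "t * q = - (q\<^sup>2 / (\<bar>p\<bar> + 1))" by (simp add: t_def power2_eq_square)
  moreover have "q\<^sup>2 / (\<bar>p\<bar> + 1) > 0" using q by (intro divide_pos_pos) auto
  ultimately show False by simp
qed

text \<open>Definiteness is postponed: for the given \<open>g\<close> the form
  \<open>[g x, y]\<close> is at first only known to be positive semidefinite, and Cauchy-Schwarz is
  wanted at that stage to compare norms.\<close>

locale semi_inner_product = vector_space smul
  for smul :: "complex \<Rightarrow> 'k::ab_group_add \<Rightarrow> 'k" +
  fixes ip :: "'k \<Rightarrow> 'k \<Rightarrow> complex"
  assumes hermitian: "hermitian_form_on smul UNIV ip"
    and nonneg: "0 \<le> Re (ip x x)"
begin

definition nrm :: "'k \<Rightarrow> real" where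
  "nrm x = sqrt (Re (ip x x))"

lemma ip_add_left: "ip (x + y) z = ip x z + ip y z"
  and ip_scale_left: "ip (smul c x) y = c * ip x y"
  and ip_cnj: "ip y x = cnj (ip x y)"
  using hermitian unfolding hermitian_form_on_def by blast+

lemma ip_add_right: "ip x (y + z) = ip x y + ip x z"
  by (metis ip_add_left ip_cnj complex_cnj_add)

lemma ip_scale_right: "ip x (smul c y) = cnj c * ip x y"
  by (metis ip_scale_left ip_cnj complex_cnj_mult)

lemma ip_minus_left: "ip (- x) y = - ip x y"
  using ip_scale_left[of "-1" x y] by simp

lemma ip_minus_right: "ip x (- y) = - ip x y"
  using ip_scale_right[of x "-1" y] by simp

lemma ip_diff_left: "ip (x - y) z = ip x z - ip y z"
  using ip_add_left[of x "- y" z] by (simp add: ip_minus_left)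

lemma ip_diff_right: "ip x (y - z) = ip x y - ip x z"
  using ip_add_right[of x y "- z"] by (simp add: ip_minus_right)

lemmas ip_simps = ip_add_left ip_add_right ip_scale_left ip_scale_right
  ip_minus_left ip_minus_right ip_diff_left ip_diff_right

lemma ip_zero_left [simp]: "ip 0 y = 0"
  using ip_scale_left[of 0 0 y] by simp

lemma ip_zero_right [simp]: "ip x 0 = 0"
  using ip_scale_right[of x 0 0] by simp

lemma Re_ip_commute: "Re (ip x y) = Re (ip y x)"
  using ip_cnj[of x y] by simp

lemma nrm_ge_0 [simp]: "0 \<le> nrm x"
  by (simp add: nrm_def nonneg)

lemma nrm_power2: "(nrm x)\<^sup>2 = Re (ip x x)"
  by (simp add: nrm_def nonneg)

lemma nrm_zero [simp]: "nrm 0 = 0"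
  by (simp add: nrm_def)

lemma nrm_scale: "nrm (smul c x) = cmod c * nrm x"
proof -
  have "ip (smul c x) (smul c x) = of_real ((cmod c)\<^sup>2) * ip x x"
    unfolding complex_norm_square by (simp add: ip_simps)
  then have "Re (ip (smul c x) (smul c x)) = (cmod c)\<^sup>2 * Re (ip x x)"
    by (simp del: of_real_power)
  then show ?thesis by (simp add: nrm_def real_sqrt_mult)
qed

lemma nrm_minus [simp]: "nrm (- x) = nrm x"
  by (simp add: nrm_def ip_simps)

lemma nrm_minus_commute: "nrm (x - y) = nrm (y - x)"
  using nrm_minus[of "x - y"] by simp

lemma nrm_add_power2: "(nrm (x + y))\<^sup>2 = (nrm x)\<^sup>2 + 2 * Re (ip x y) + (nrm y)\<^sup>2"
  using Re_ip_commute[of x y] by (simp add: nrm_power2 ip_simps)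

lemma cauchy_schwarz: "Re (ip x y) \<le> nrm x * nrm y"
proof -
  have quad: "0 \<le> (nrm x)\<^sup>2 + 2 * t * Re (ip x y) + t\<^sup>2 * (nrm y)\<^sup>2" for t :: real
    using zero_le_power2[of "nrm (x + smul (of_real t) y)"]
    unfolding nrm_add_power2
    by (simp add: ip_simps nrm_scale power_mult_distrib mult.assoc)
  have "(Re (ip x y))\<^sup>2 \<le> (nrm x * nrm y)\<^sup>2"
  proof (cases "nrm y = 0")
    \<comment> \<open>Without definiteness \<open>y\<close> may be nonzero here. The quadratic in
      \<open>t\<close> degenerates to an affine function, which is bounded below only if its slope
      vanishes.\<close>
    case True
    have "Re (ip x y) = 0"
    proof (rule ccontr)
      assume "Re (ip x y) \<noteq> 0"
      then have "2 * (- ((nrm x)\<^sup>2 + 1) / (2 * Re (ip x y))) * Re (ip x y) = - ((nrm x)\<^sup>2 + 1)"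
        by (simp add: field_simps)
      with quad[of "- ((nrm x)\<^sup>2 + 1) / (2 * Re (ip x y))"] True show False by simp
    qed
    then show ?thesis by simp
  next
    case False
    \<comment> \<open>The minimiser of the quadratic.\<close>
    define t where "t = - Re (ip x y) / (nrm y)\<^sup>2"
    have "(nrm x)\<^sup>2 + 2 * t * Re (ip x y) + t\<^sup>2 * (nrm y)\<^sup>2 = (nrm x)\<^sup>2 - (Re (ip x y))\<^sup>2 / (nrm y)\<^sup>2"
      using False by (simp add: t_def field_simps power2_eq_square)
    then have "(Re (ip x y))\<^sup>2 / (nrm y)\<^sup>2 \<le> (nrm x)\<^sup>2" using quad[of t] by simp
    then show ?thesis using False by (simp add: pos_divide_le_eq power_mult_distrib)
  qed
  then show ?thesis by (meson abs_le_square_iff abs_le_D1 abs_of_nonneg mult_nonneg_nonneg nrm_ge_0 power2_le_imp_le)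
qed

lemma abs_Re_ip_le: "\<bar>Re (ip x y)\<bar> \<le> nrm x * nrm y"
  using cauchy_schwarz[of x y] cauchy_schwarz[of "- x" y] by (simp add: ip_simps abs_le_iff)

lemma nrm_triangle: "nrm (x + y) \<le> nrm x + nrm y"
proof (rule power2_le_imp_le)
  show "(nrm (x + y))\<^sup>2 \<le> (nrm x + nrm y)\<^sup>2"
    using cauchy_schwarz[of x y] by (simp add: nrm_add_power2 power2_sum)
qed simp

lemma nrm_triangle_diff: "nrm (x - y) \<le> nrm x + nrm y"
  using nrm_triangle[of x "- y"] by simp

section \<open>Sequential convergence and bounded linear operators in the seminorm\<close>

definition tends :: "(nat \<Rightarrow> 'k) \<Rightarrow> 'k \<Rightarrow> bool" where
  "tends u l \<longleftrightarrow> (\<lambda>n. nrm (u n - l)) \<longlonglongrightarrow> 0"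

definition cauchy :: "(nat \<Rightarrow> 'k) \<Rightarrow> bool" where
  "cauchy u \<longleftrightarrow> (\<forall>e>0. \<exists>M. \<forall>m\<ge>M. \<forall>n\<ge>M. nrm (u m - u n) < e)"

definition bop :: "('k \<Rightarrow> 'k) \<Rightarrow> bool" where
  "bop D \<longleftrightarrow> (\<forall>x y. D (x + y) = D x + D y) \<and> (\<forall>c x. D (smul c x) = smul c (D x)) \<and>
     (\<exists>C. \<forall>x. nrm (D x) \<le> C * nrm x)"

lemma tendsI:
  assumes "\<And>n. nrm (u n - l) \<le> b n" "b \<longlonglongrightarrow> 0"
  shows "tends u l"
  unfolding tends_def
  by (rule tendsto_sandwich[OF _ _ tendsto_const assms(2)]) (use assms(1) in auto)

lemma tends_Suc: "tends u l \<Longrightarrow> tends (\<lambda>n. u (Suc n)) l"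
  unfolding tends_def by (rule LIMSEQ_Suc)

lemma tends_const: "tends (\<lambda>_. l) l"
  by (simp add: tends_def)

lemma tends_add:
  assumes "tends u a" "tends v b"
  shows "tends (\<lambda>n. u n + v n) (a + b)"
proof (rule tendsI)
  show "nrm (u n + v n - (a + b)) \<le> nrm (u n - a) + nrm (v n - b)" for n
    using nrm_triangle[of "u n - a" "v n - b"] by (simp add: algebra_simps)
  show "(\<lambda>n. nrm (u n - a) + nrm (v n - b)) \<longlonglongrightarrow> 0"
    using tendsto_add[OF assms[unfolded tends_def]] by simp
qed

lemma tends_scale:
  assumes "tends u a"
  shows "tends (\<lambda>n. smul c (u n)) (smul c a)"
proof (rule tendsI)
  show "nrm (smul c (u n) - smul c a) \<le> cmod c * nrm (u n - a)" for n
    by (simp flip: scale_right_diff_distrib add: nrm_scale)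
  show "(\<lambda>n. cmod c * nrm (u n - a)) \<longlonglongrightarrow> 0"
    using tendsto_mult_left[OF assms[unfolded tends_def]] by simp
qed

lemma tends_ip:
  assumes "tends u a"
  shows "(\<lambda>n. Re (ip (u n) y)) \<longlonglongrightarrow> Re (ip a y)"
proof (rule LIM_zero_cancel, rule Lim_null_comparison)
  show "\<forall>\<^sub>F n in sequentially. norm (Re (ip (u n) y) - Re (ip a y)) \<le> nrm (u n - a) * nrm y"
    using abs_Re_ip_le[of "u _ - a" y] by (simp add: ip_simps)
  show "(\<lambda>n. nrm (u n - a) * nrm y) \<longlonglongrightarrow> 0"
    using tendsto_mult_right[OF assms[unfolded tends_def]] by simp
qed

lemma tends_nrm:
  assumes "tends u a"
  shows "(\<lambda>n. nrm (u n)) \<longlonglongrightarrow> nrm a"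
proof (rule LIM_zero_cancel, rule Lim_null_comparison)
  show "\<forall>\<^sub>F n in sequentially. norm (nrm (u n) - nrm a) \<le> nrm (u n - a)"
  proof (rule always_eventually, rule allI)
    fix n
    show "norm (nrm (u n) - nrm a) \<le> nrm (u n - a)"
      using nrm_triangle[of "u n - a" a] nrm_triangle[of "a - u n" "u n"]
      by (simp add: nrm_minus_commute[of a])
  qed
qed (use assms in \<open>simp add: tends_def\<close>)

lemma bopI:
  assumes "\<And>x y. D (x + y) = D x + D y" "\<And>c x. D (smul c x) = smul c (D x)"
    "\<And>x. nrm (D x) \<le> C * nrm x"
  shows "bop D"
  using assms unfolding bop_def by blast

lemma bop_plus: "bop D \<Longrightarrow> D (x + y) = D x + D y"
  and bop_smul: "bop D \<Longrightarrow> D (smul c x) = smul c (D x)"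
  by (auto simp: bop_def)

lemma bop_zero: "bop D \<Longrightarrow> D 0 = 0"
  using bop_smul[of D 0 0] by simp

lemma bop_minus: "bop D \<Longrightarrow> D (- x) = - D x"
  using bop_smul[of D "-1" x] by simp

lemma bop_diff: "bop D \<Longrightarrow> D (x - y) = D x - D y"
  using bop_plus[of D x "- y"] by (simp add: bop_minus)

lemma bop_bound:
  assumes "bop D"
  obtains C where "0 < C" "\<And>x. nrm (D x) \<le> C * nrm x"
proof -
  obtain C where C: "\<And>x. nrm (D x) \<le> C * nrm x" using assms unfolding bop_def by blast
  have "nrm (D x) \<le> (\<bar>C\<bar> + 1) * nrm x" for x
    by (rule order_trans[OF C]) (intro mult_right_mono, auto)
  then show ?thesis using that[of "\<bar>C\<bar> + 1"] by simp
qed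

lemma bop_id: "bop (\<lambda>x. x)"
  by (rule bopI[where C = 1]) auto

lemma bop_comp:
  assumes "bop D" "bop E"
  shows "bop (\<lambda>x. D (E x))"
proof -
  obtain C where C: "0 < C" "\<And>x. nrm (D x) \<le> C * nrm x" using bop_bound[OF assms(1)] by blast
  obtain K where K: "0 < K" "\<And>x. nrm (E x) \<le> K * nrm x" using bop_bound[OF assms(2)] by blast
  show ?thesis
  proof (rule bopI)
    show "nrm (D (E x)) \<le> (C * K) * nrm x" for x
      using order_trans[OF C(2)[of "E x"] mult_left_mono[OF K(2)[of x]]] C(1) by (simp add: mult.assoc)
  qed (use assms in \<open>auto simp: bop_plus bop_smul\<close>)
qed

lemma bop_sum:
  assumes "bop D" "bop E"
  shows "bop (\<lambda>x. D x + E x)"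
proof -
  obtain C where C: "0 < C" "\<And>x. nrm (D x) \<le> C * nrm x" using bop_bound[OF assms(1)] by blast
  obtain K where K: "0 < K" "\<And>x. nrm (E x) \<le> K * nrm x" using bop_bound[OF assms(2)] by blast
  show ?thesis
  proof (rule bopI)
    show "nrm (D x + E x) \<le> (C + K) * nrm x" for x
      using C(2)[of x] K(2)[of x] nrm_triangle[of "D x" "E x"] by (simp add: algebra_simps)
  qed (use assms in \<open>auto simp: bop_plus bop_smul scale_right_distrib\<close>)
qed

lemma bop_smult:
  assumes "bop D"
  shows "bop (\<lambda>x. smul c (D x))"
proof -
  obtain C where C: "0 < C" "\<And>x. nrm (D x) \<le> C * nrm x" using bop_bound[OF assms(1)] by blast
  show ?thesis
  proof (rule bopI)
    show "nrm (smul c (D x)) \<le> (cmod c * C) * nrm x" for x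
      using mult_left_mono[OF C(2), of "cmod c" x] by (simp add: nrm_scale mult.assoc)
  qed (use assms in \<open>auto simp: bop_plus bop_smul scale_right_distrib mult.commute\<close>)
qed

lemma bop_difference:
  assumes "bop D" "bop E"
  shows "bop (\<lambda>x. D x - E x)"
  using bop_sum[OF assms(1) bop_smult[OF assms(2), of "-1"]] by simp

lemma tends_bop:
  assumes "bop D" "tends u a"
  shows "tends (\<lambda>n. D (u n)) (D a)"
proof -
  obtain C where C: "0 < C" "\<And>x. nrm (D x) \<le> C * nrm x" using bop_bound[OF assms(1)] by blast
  show ?thesis
  proof (rule tendsI)
    show "nrm (D (u n) - D a) \<le> C * nrm (u n - a)" for n
      using C(2)[of "u n - a"] by (simp add: bop_diff[OF assms(1)])
    show "(\<lambda>n. C * nrm (u n - a)) \<longlonglongrightarrow> 0"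
      using tendsto_mult_left[OF assms(2)[unfolded tends_def]] by simp
  qed
qed

end

section \<open>Hilbert spaces: Riesz representation and adjoints\<close>

locale hilbert_space = semi_inner_product smul ip
  for smul :: "complex \<Rightarrow> 'k::ab_group_add \<Rightarrow> 'k" and ip +
  assumes definite: "Re (ip x x) = 0 \<Longrightarrow> x = 0"
    and complete: "cauchy u \<Longrightarrow> \<exists>l. tends u l"
begin

lemma nrm_eq_0: "nrm x = 0 \<longleftrightarrow> x = 0"
  using definite by (auto simp: nrm_def)

lemma tends_unique:
  assumes "tends u a" "tends u b"
  shows "a = b"
proof -
  have "nrm (a - b) \<le> nrm (u n - b) + nrm (u n - a)" for n
    using nrm_triangle_diff[of "u n - b" "u n - a"] by simp
  moreover have "(\<lambda>n. nrm (u n - b) + nrm (u n - a)) \<longlonglongrightarrow> 0"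
    using tendsto_add[OF assms(2,1)[unfolded tends_def]] by simp
  ultimately have "nrm (a - b) \<le> 0" by (intro LIMSEQ_le_const) auto
  then have "nrm (a - b) = 0" by (simp add: antisym)
  then show ?thesis by (simp add: nrm_eq_0)
qed

lemma ip_eqI:
  assumes "\<And>x. ip x a = ip x b"
  shows "a = b"
  using assms[of "a - b"] definite[of "a - b"] by (simp add: ip_simps)

text \<open>Riesz representation: the representing vector minimises \<open>nrm u ^ 2 - 2 * Re (ip (A u) y)\<close>.\<close>

lemma ex_adjoint_vector:
  assumes A: "bop A"
  shows "\<exists>z. \<forall>x. ip (A x) y = ip x z"
proof -
  obtain C where C: "0 < C" "\<And>x. nrm (A x) \<le> C * nrm x" using bop_bound[OF A] by blast
  define Q where "Q u = (nrm u)\<^sup>2 - 2 * Re (ip (A u) y)" for u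
  define K where "K = C * nrm y"
  \<comment> \<open>Completing the square in \<open>nrm u\<close> bounds \<open>Q\<close> from
    below.\<close>
  have "- K\<^sup>2 \<le> Q u" for u
  proof -
    have "Re (ip (A u) y) \<le> nrm (A u) * nrm y" by (rule cauchy_schwarz)
    also have "\<dots> \<le> K * nrm u"
      using mult_right_mono[OF C(2)[of u], of "nrm y"] by (simp add: K_def mult_ac)
    finally have "Re (ip (A u) y) \<le> K * nrm u" .
    moreover have "0 \<le> (nrm u - K)\<^sup>2" by simp
    ultimately show ?thesis unfolding Q_def by (simp add: power2_diff algebra_simps)
  qed
  then have bdd: "bdd_below (range Q)" by (intro bdd_belowI[of _ "- K\<^sup>2"]) auto
  define d where "d = Inf (range Q)"
  have d: "d \<le> Q u" for u unfolding d_def using bdd by (intro cInf_lower) auto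
  have "\<exists>u. Q u < d + inverse (real (Suc n))" for n
  proof -
    have "Inf (range Q) < d + inverse (real (Suc n))" by (simp add: d_def)
    then show ?thesis using bdd by (subst (asm) cInf_less_iff) auto
  qed
  then obtain u where u: "\<And>n. Q (u n) < d + inverse (real (Suc n))" by metis
  \<comment> \<open>Parallelogram law; the linear part of \<open>Q\<close> cancels. Since
    \<open>Q\<close> is at least \<open>d\<close> at the midpoint, a minimising sequence is
    Cauchy.\<close>
  have par: "(nrm (v - w))\<^sup>2 = 2 * Q v + 2 * Q w - 4 * Q (smul (1/2) (v + w))" for v w
    by (simp add: Q_def bop_plus[OF A] bop_smul[OF A] nrm_power2 ip_simps algebra_simps)
  have est: "(nrm (u m - u n))\<^sup>2 \<le> 2 * inverse (real (Suc m)) + 2 * inverse (real (Suc n))" for m n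
    unfolding par using u[of m] u[of n] d[of "smul (1/2) (u m + u n)"] by simp
  have "cauchy u"
    unfolding cauchy_def
  proof (intro allI impI)
    fix e :: real assume e: "0 < e"
    then obtain M where M: "inverse (real (Suc M)) < e\<^sup>2 / 4"
      using reals_Archimedean[of "e\<^sup>2 / 4"] by auto
    have "nrm (u m - u n) < e" if "M \<le> m" "M \<le> n" for m n
    proof -
      have "inverse (real (Suc m)) \<le> inverse (real (Suc M))"
        "inverse (real (Suc n)) \<le> inverse (real (Suc M))" using that by simp_all
      with est[of m n] M have "(nrm (u m - u n))\<^sup>2 < e\<^sup>2" by linarith
      then show ?thesis using e by (simp add: power2_less_imp_less)
    qed
    then show "\<exists>M. \<forall>m\<ge>M. \<forall>n\<ge>M. nrm (u m - u n) < e" by blast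
  qed
  then obtain z where z: "tends u z" using complete by blast
  have re: "Re (ip z h) = Re (ip (A h) y)" for h
  proof -
    \<comment> \<open>The variation of \<open>Q\<close> in direction \<open>h\<close> is estimated
      at \<open>u n\<close>, up to the error \<open>inverse (real (Suc n))\<close>, and then passed
      to the limit.\<close>
    have "0 \<le> t\<^sup>2 * (nrm h)\<^sup>2 + 2 * t * (Re (ip z h) - Re (ip (A h) y))" for t :: real
    proof -
      have le: "- inverse (real (Suc n)) \<le> t\<^sup>2 * (nrm h)\<^sup>2 + 2 * t * (Re (ip (u n) h) - Re (ip (A h) y))" for n
      proof -
        have "Q (u n + smul (of_real t) h) = Q (u n) + (t\<^sup>2 * (nrm h)\<^sup>2 + 2 * t * (Re (ip (u n) h) - Re (ip (A h) y)))"
          unfolding Q_def nrm_add_power2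
          by (simp add: bop_plus[OF A] bop_smul[OF A] nrm_scale ip_simps power_mult_distrib algebra_simps)
        then show ?thesis using u[of n] d[of "u n + smul (of_real t) h"] by simp
      qed
      have lim0: "(\<lambda>n. - inverse (real (Suc n))) \<longlonglongrightarrow> - 0"
        by (intro tendsto_minus LIMSEQ_inverse_real_of_nat)
      have lim: "(\<lambda>n. t\<^sup>2 * (nrm h)\<^sup>2 + 2 * t * (Re (ip (u n) h) - Re (ip (A h) y)))
          \<longlonglongrightarrow> t\<^sup>2 * (nrm h)\<^sup>2 + 2 * t * (Re (ip z h) - Re (ip (A h) y))"
        by (intro tendsto_intros tends_ip z)
      have "- 0 \<le> t\<^sup>2 * (nrm h)\<^sup>2 + 2 * t * (Re (ip z h) - Re (ip (A h) y))"
        by (rule LIMSEQ_le[OF lim0 lim]) (use le in blast)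
      then show ?thesis by simp
    qed
    then have "Re (ip z h) - Re (ip (A h) y) = 0" by (rule linear_nonneg_imp_zero)
    then show ?thesis by simp
  qed
  have "ip (A x) y = ip x z" for x
  proof (rule complex_eqI)
    show "Re (ip (A x) y) = Re (ip x z)" using re[of x] Re_ip_commute[of x z] by simp
    \<comment> \<open>Imaginary parts are real parts after multiplying the test vector by the
      imaginary unit.\<close>
    show "Im (ip (A x) y) = Im (ip x z)"
      using re[of "smul \<i> x"] Re_ip_commute[of "smul \<i> x" z]
      by (simp add: bop_smul[OF A] ip_simps)
  qed
  then show ?thesis by blast
qed

text \<open>Representing vectors are unique by definiteness, hence depend linearly on
  \<open>y\<close>. Cauchy-Schwarz applied to \<open>ip (A (A' x)) x\<close> bounds
  \<open>A'\<close> by the constant of \<open>A\<close>.\<close>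

lemma ex_adjoint:
  assumes A: "bop A"
  obtains A' where "bop A'" "\<And>x y. ip (A x) y = ip x (A' y)"
proof -
  obtain A' where A': "\<And>x y. ip (A x) y = ip x (A' y)"
    using ex_adjoint_vector[OF A] by metis
  obtain C where C: "0 < C" "\<And>x. nrm (A x) \<le> C * nrm x" using bop_bound[OF A] by blast
  have "bop A'"
  proof (rule bopI)
    show "A' (x + y) = A' x + A' y" for x y
      by (rule ip_eqI) (simp add: ip_simps flip: A')
    show "A' (smul c x) = smul c (A' x)" for c x
      by (rule ip_eqI) (simp add: ip_simps flip: A')
    show "nrm (A' x) \<le> C * nrm x" for x
    proof (cases "nrm (A' x) = 0")
      case False
      have "nrm (A' x) * nrm (A' x) = Re (ip (A (A' x)) x)"
        using nrm_power2[of "A' x"] A'[of "A' x" x] by (simp add: power2_eq_square)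
      also have "\<dots> \<le> nrm (A (A' x)) * nrm x" by (rule cauchy_schwarz)
      also have "\<dots> \<le> nrm (A' x) * (C * nrm x)"
        using mult_right_mono[OF C(2)[of "A' x"], of "nrm x"] by (simp add: mult_ac)
      finally show ?thesis using False nrm_ge_0[of "A' x"] by (simp del: nrm_ge_0)
    qed (use C in simp)
  qed
  then show ?thesis using A' that by blast
qed

section \<open>The modulus of a self-adjoint operator\<close>

text \<open>A limit \<open>Y\<close> of the iteration satisfies \<open>Y = (X + Y\<^sup>2) / 2\<close>, that is, \<open>(1 - Y)\<^sup>2 = 1 - X\<close>.\<close>

primrec root_iter :: "('k \<Rightarrow> 'k) \<Rightarrow> nat \<Rightarrow> 'k \<Rightarrow> 'k" where
  "root_iter X 0 = (\<lambda>_. 0)"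
| "root_iter X (Suc n) = (\<lambda>x. smul (1/2) (X x + root_iter X n (root_iter X n x)))"

text \<open>The scalar iteration for \<open>X = 1\<close> majorises all increments of the operator iteration.\<close>

primrec root_major :: "nat \<Rightarrow> real" where
  "root_major 0 = 0"
| "root_major (Suc n) = (1 + (root_major n)\<^sup>2) / 2"

text \<open>The map from \<open>t\<close> to \<open>(1 + t^2) / 2\<close> is increasing for
  nonnegative \<open>t\<close> and fixes 1, so its iterates from 0 increase and never pass
  1.\<close>

lemma root_major_bounds: "0 \<le> root_major n \<and> root_major n \<le> root_major (Suc n) \<and> root_major n \<le> 1"
proof (induction n)
  case (Suc n)
  have "(root_major n)\<^sup>2 \<le> (root_major (Suc n))\<^sup>2" using Suc by (intro power_mono) blast+
  moreover have "(root_major n)\<^sup>2 \<le> 1" using Suc by (simp only: power_le_one)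
  ultimately show ?case
    using Suc by (simp add: divide_right_mono)
qed simp

lemma root_major_convergent: "convergent root_major"
proof -
  have "incseq root_major" using root_major_bounds by (intro incseq_SucI) blast
  then obtain L where "root_major \<longlonglongrightarrow> L"
    using incseq_convergent[of root_major 1] root_major_bounds by blast
  then show ?thesis by (rule convergentI)
qed

section \<open>Convergence of the square root iteration for a contraction\<close>

context
  fixes X :: "'k \<Rightarrow> 'k"
  assumes X: "bop X" and contr: "nrm (X x) \<le> nrm x"
begin

lemma bop_root_iter: "bop (root_iter X n)"
proof (induction n)
  case 0
  then show ?case by (auto intro: bopI[where C = 0])
next
  case (Suc n)
  show ?case unfolding root_iter.simps by (rule bop_smult[OF bop_sum[OF X bop_comp[OF Suc Suc]]])
qed

text \<open>Every iterate is a polynomial in \<open>X\<close>.\<close>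

lemma root_iter_commute:
  assumes "bop T" "\<And>x. T (X x) = X (T x)"
  shows "T (root_iter X n x) = root_iter X n (T x)"
proof (induction n arbitrary: x)
  case 0
  then show ?case by (simp add: bop_zero[OF assms(1)])
next
  case (Suc n)
  then show ?case by (simp add: bop_smul[OF assms(1)] bop_plus[OF assms(1)] assms(2))
qed

lemma root_iter_commute_iter: "root_iter X m (root_iter X n x) = root_iter X n (root_iter X m x)"
proof (rule root_iter_commute[where T = "root_iter X m"])
  show "root_iter X m (X x) = X (root_iter X m x)" for x
    by (rule root_iter_commute[where T = X and n = m and x = x, OF X refl, symmetric])
qed (rule bop_root_iter)

lemma root_iter_bound: "nrm (root_iter X n x) \<le> root_major n * nrm x"
proof (induction n arbitrary: x)
  case (Suc n)
  have "nrm (root_iter X n (root_iter X n x)) \<le> root_major n * (root_major n * nrm x)"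
    using root_major_bounds[of n] order_trans[OF Suc[of "root_iter X n x"] mult_left_mono[OF Suc[of x]]]
    by blast
  then have "nrm (X x + root_iter X n (root_iter X n x)) \<le> nrm x + root_major n * (root_major n * nrm x)"
    using nrm_triangle[of "X x" "root_iter X n (root_iter X n x)"] contr[of x] by linarith
  then show ?case by (simp add: nrm_scale power2_eq_square algebra_simps del: scale_right_distrib)
qed simp

text \<open>Consecutive iterates commute, so an increment is half a difference of squares and
  factors as \<open>(Z - Y) (Z + Y) / 2\<close>. The induction hypothesis bounds the first factor,
  \<open>root_iter_bound\<close> the second, and the scalar iteration factors in the same
  way.\<close>

lemma root_iter_step:
  "nrm (root_iter X (Suc n) x - root_iter X n x) \<le> (root_major (Suc n) - root_major n) * nrm x"
proof (induction n arbitrary: x)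
  case 0
  then show ?case using contr[of x] by (simp add: nrm_scale bop_zero[OF X])
next
  case (Suc n)
  let ?Y = "root_iter X n" and ?Z = "root_iter X (Suc n)"
  let ?y = "root_major n" and ?z = "root_major (Suc n)"
  define w where "w = ?Z x + ?Y x"
  have cancel: "a - b = (a + c) - (c + b)" for a b c :: 'k by simp
  have half: "1/2 * ((z - y) * ((z + y) * c)) = ((1 + z\<^sup>2) / 2 - (1 + y\<^sup>2) / 2) * c" for z y c :: real
    by (simp add: power2_eq_square field_simps)
  have "root_iter X (Suc (Suc n)) x = smul (1/2) (X x + ?Z (?Z x))"
    and "?Z x = smul (1/2) (X x + ?Y (?Y x))"
    by (simp_all only: root_iter.simps)
  then have "root_iter X (Suc (Suc n)) x - ?Z x =
      smul (1/2) (X x + ?Z (?Z x)) - smul (1/2) (X x + ?Y (?Y x))"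
    by (rule arg_cong2)
  also have "\<dots> = smul (1/2) (?Z (?Z x) - ?Y (?Y x))"
    by (simp only: scale_right_diff_distrib[symmetric] add_diff_cancel_left)
  \<comment> \<open>The mixed terms of the product agree by commutation and cancel.\<close>
  also have "?Z (?Z x) - ?Y (?Y x) = ?Z w - ?Y w"
    unfolding w_def bop_plus[OF bop_root_iter] root_iter_commute_iter[of n "Suc n"] by (rule cancel)
  finally have eq: "nrm (root_iter X (Suc (Suc n)) x - ?Z x) = 1/2 * nrm (?Z w - ?Y w)"
    by (simp only: nrm_scale) simp
  have "nrm w \<le> (?z + ?y) * nrm x"
    unfolding w_def distrib_right
    using nrm_triangle[of "?Z x" "?Y x"] root_iter_bound[of n x] root_iter_bound[of "Suc n" x] by linarith
  then have "nrm (?Z w - ?Y w) \<le> (?z - ?y) * ((?z + ?y) * nrm x)"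
    using root_major_bounds[of n] by (intro order_trans[OF Suc mult_left_mono]) linarith+
  then have "nrm (root_iter X (Suc (Suc n)) x - ?Z x) \<le> 1/2 * ((?z - ?y) * ((?z + ?y) * nrm x))"
    unfolding eq by linarith
  also have "1/2 * ((?z - ?y) * ((?z + ?y) * nrm x)) = (root_major (Suc (Suc n)) - ?z) * nrm x"
    by (simp only: root_major.simps half)
  finally show ?case .
qed

lemma root_iter_diff:
  assumes "n \<le> m"
  shows "nrm (root_iter X m x - root_iter X n x) \<le> (root_major m - root_major n) * nrm x"
  using assms
proof (induction m rule: dec_induct)
  case (step m)
  then show ?case
    using nrm_triangle[of "root_iter X (Suc m) x - root_iter X m x" "root_iter X m x - root_iter X n x"]
      root_iter_step[of m x]
    by (simp add: left_diff_distrib del: root_iter.simps root_major.simps)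
qed simp

lemma root_iter_tends: "\<exists>l. tends (\<lambda>n. root_iter X n x) l"
proof (rule complete, unfold cauchy_def, intro allI impI)
  fix e :: real assume e: "0 < e"
  have "Cauchy root_major" using root_major_convergent by (rule convergent_Cauchy)
  \<comment> \<open>The summand 1 in the denominator covers \<open>nrm x = 0\<close>.\<close>
  then obtain M where M: "\<And>m n. M \<le> m \<Longrightarrow> M \<le> n \<Longrightarrow> \<bar>root_major m - root_major n\<bar> < e / (nrm x + 1)"
    using e divide_pos_pos[OF e add_nonneg_pos[OF nrm_ge_0 zero_less_one, of x]]
    unfolding Cauchy_def dist_real_def by blast
  have less: "nrm (root_iter X m x - root_iter X n x) < e" if "M \<le> n" "n \<le> m" for m n
  proof -
    have "nrm (root_iter X m x - root_iter X n x) \<le> \<bar>root_major m - root_major n\<bar> * nrm x"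
      by (rule order_trans[OF root_iter_diff[OF that(2)]]) (intro mult_right_mono, auto)
    also have "\<dots> \<le> e / (nrm x + 1) * nrm x"
      using M[of m n] that by (intro mult_right_mono) auto
    also have "\<dots> < e" using e by (simp add: field_simps add_pos_nonneg)
    finally show ?thesis .
  qed
  have "nrm (root_iter X m x - root_iter X n x) < e" if "M \<le> m" "M \<le> n" for m n
    using less[of m n] less[of n m] that nrm_minus_commute[of "root_iter X m x"] by (cases "n \<le> m") auto
  then show "\<exists>M. \<forall>m\<ge>M. \<forall>n\<ge>M. nrm (root_iter X m x - root_iter X n x) < e" by blast
qed

text \<open>\<open>Y\<close> is the pointwise limit of the iterates. Linearity, the bound and
  commutation with \<open>T\<close> survive the limit, the last because \<open>T\<close> is
  continuous.\<close>

lemma ex_contraction_root: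
  obtains Y where "bop Y" "\<And>x. nrm (Y x) \<le> nrm x"
    "\<And>x. smul (1/2) (X x + Y (Y x)) = Y x"
    "\<And>T x. bop T \<Longrightarrow> (\<And>x. T (X x) = X (T x)) \<Longrightarrow> T (Y x) = Y (T x)"
proof -
  obtain Y where Y: "\<And>x. tends (\<lambda>n. root_iter X n x) (Y x)"
    using root_iter_tends by metis
  have plus: "Y (x + y) = Y x + Y y" for x y
    using tends_unique[OF Y[of "x + y"]] tends_add[OF Y Y, of x y]
    by (simp add: bop_plus[OF bop_root_iter])
  have scale: "Y (smul c x) = smul c (Y x)" for c x
    using tends_unique[OF Y[of "smul c x"]] tends_scale[OF Y, of c x]
    by (simp add: bop_smul[OF bop_root_iter])
  have iter: "nrm (root_iter X n x) \<le> nrm x" for n x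
    by (rule order_trans[OF root_iter_bound])
      (use root_major_bounds[of n] in \<open>simp add: mult_left_le_one_le\<close>)
  have bound: "nrm (Y x) \<le> nrm x" for x
    by (rule LIMSEQ_le_const2[OF tends_nrm[OF Y]]) (use iter in auto)
  have bopY: "bop Y" by (rule bopI[where C = 1]) (simp_all add: plus scale bound)
  have comm: "T (Y x) = Y (T x)" if T: "bop T" "\<And>x. T (X x) = X (T x)" for T x
    using tends_unique[OF Y[of "T x"]] tends_bop[OF T(1) Y, of x] by (simp add: root_iter_commute[OF T])
  \<comment> \<open>Pointwise convergence respects this product because the outer iterates are
    contractions, uniformly in \<open>n\<close>.\<close>
  have "tends (\<lambda>n. root_iter X n (root_iter X n x)) (Y (Y x))" for x
  proof (rule tendsI)
    fix n
    have *: "root_iter X n (root_iter X n x) - Y (Y x) =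
        root_iter X n (root_iter X n x - Y x) + (root_iter X n (Y x) - Y (Y x))"
      by (simp add: bop_diff[OF bop_root_iter])
    show "nrm (root_iter X n (root_iter X n x) - Y (Y x)) \<le>
        nrm (root_iter X n x - Y x) + nrm (root_iter X n (Y x) - Y (Y x))"
      using nrm_triangle[of "root_iter X n (root_iter X n x - Y x)" "root_iter X n (Y x) - Y (Y x)"]
        iter[of n "root_iter X n x - Y x"] unfolding * by linarith
  next
    show "(\<lambda>n. nrm (root_iter X n x - Y x) + nrm (root_iter X n (Y x) - Y (Y x))) \<longlonglongrightarrow> 0"
      using tendsto_add[OF Y[of x, unfolded tends_def] Y[of "Y x", unfolded tends_def]] by simp
  qed
  then have "tends (\<lambda>n. smul (1/2) (X x + root_iter X n (root_iter X n x))) (smul (1/2) (X x + Y (Y x)))" for x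
    by (intro tends_scale tends_add tends_const)
  \<comment> \<open>The recursion computes the shifted sequence, whose limit is again
    \<open>Y x\<close>.\<close>
  then have "smul (1/2) (X x + Y (Y x)) = Y x" for x
    by (rule tends_unique[OF _ tends_Suc[OF Y[of x], unfolded root_iter.simps]])
  then show ?thesis using that bopY bound comm by blast
qed

end

text \<open>With \<open>X = 1 - B^2\<close> and the fixed point \<open>Y\<close> of the iteration,
  \<open>S = 1 - Y\<close> satisfies \<open>S^2 = 1 - X = B^2\<close>. An operator commuting with
  \<open>B\<close> commutes with \<open>X\<close>, hence with \<open>Y\<close> and
  \<open>S\<close>.\<close>

lemma ex_modulus:
  assumes B: "bop B" and sa: "\<And>x y. ip (B x) y = ip x (B y)" and contr: "\<And>x. nrm (B x) \<le> nrm x"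
  obtains S where "bop S" "\<And>x. S (S x) = B (B x)" "\<And>x. 0 \<le> Re (ip (S x) x)"
    "\<And>T x. bop T \<Longrightarrow> (\<And>x. T (B x) = B (T x)) \<Longrightarrow> T (S x) = S (T x)"
proof -
  define X where "X x = x - B (B x)" for x
  have X: "bop X" unfolding X_def by (rule bop_difference[OF bop_id bop_comp[OF B B]])
  have Xc: "nrm (X x) \<le> nrm x" for x
  proof (rule power2_le_imp_le)
    \<comment> \<open>Self-adjointness turns the cross term into \<open>nrm (B x)\<close>;
      contractivity of \<open>B\<close> then lets it absorb the last term.\<close>
    have "(nrm (X x))\<^sup>2 = (nrm x)\<^sup>2 - 2 * (nrm (B x))\<^sup>2 + (nrm (B (B x)))\<^sup>2"
      using nrm_add_power2[of x "- B (B x)"] sa[of x "B x"] by (simp add: X_def ip_simps nrm_power2)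
    moreover have "(nrm (B (B x)))\<^sup>2 \<le> (nrm (B x))\<^sup>2" using contr by (intro power_mono) auto
    moreover have "0 \<le> (nrm (B x))\<^sup>2" by simp
    ultimately show "(nrm (X x))\<^sup>2 \<le> (nrm x)\<^sup>2" by linarith
  qed simp
  obtain Y where Y: "bop Y" "\<And>x. nrm (Y x) \<le> nrm x"
      "\<And>x. smul (1/2) (X x + Y (Y x)) = Y x"
      "\<And>T x. bop T \<Longrightarrow> (\<And>x. T (X x) = X (T x)) \<Longrightarrow> T (Y x) = Y (T x)"
    using ex_contraction_root[OF X Xc] by blast
  define S where "S x = x - Y x" for x
  show ?thesis
  proof (rule that[of S])
    show "bop S" unfolding S_def by (rule bop_difference[OF bop_id Y(1)])
    show "S (S x) = B (B x)" for x
    proof -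
      have "X x + Y (Y x) = smul 2 (smul (1/2) (X x + Y (Y x)))" by simp
      also have "\<dots> = smul 2 (Y x)" by (simp only: Y(3))
      also have "\<dots> = Y x + Y x" using scale_left_distrib[of 1 1 "Y x"] by simp
      finally have *: "Y (Y x) = Y x + Y x - X x" by (simp add: algebra_simps)
      show ?thesis by (simp add: S_def bop_diff[OF Y(1)] * X_def)
    qed
    \<comment> \<open>Positivity of \<open>1 - Y\<close> is Cauchy-Schwarz for the contraction
      \<open>Y\<close>.\<close>
    show "0 \<le> Re (ip (S x) x)" for x
      using cauchy_schwarz[of "Y x" x] mult_right_mono[OF Y(2)[of x], of "nrm x"] nrm_power2[of x]
      by (simp add: S_def ip_simps power2_eq_square)
    show "T (S x) = S (T x)" if "bop T" "\<And>x. T (B x) = B (T x)" for T x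
      using Y(4)[of T x] that by (simp add: S_def X_def bop_diff)
  qed
qed

end

section \<open>Completeness and equivalent norms\<close>

context semi_inner_product begin

text \<open>The sequence must stay in \<open>V\<close>, because \<open>ip_dist\<close> agrees with
  the seminorm distance only there and is 0 elsewhere.\<close>

lemma limitin_ip_dist:
  assumes "Metric_space V (ip_dist V ip)" and V: "range u \<subseteq> V"
  shows "limitin (Metric_space.mtopology V (ip_dist V ip)) u l sequentially \<longleftrightarrow> l \<in> V \<and> tends u l"
proof -
  interpret Metric_space V "ip_dist V ip" by fact
  have dist: "ip_dist V ip (u n) l = nrm (u n - l)" if "l \<in> V" for n
    using V that by (auto simp: ip_dist_def nrm_def)
  have "u n \<in> V" for n using V by auto
  then show ?thesis
    unfolding limit_metric_sequentially tends_def LIMSEQ_iff by (auto simp: dist)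
qed

lemma MCauchy_ip_dist:
  assumes "Metric_space V (ip_dist V ip)"
  shows "Metric_space.MCauchy V (ip_dist V ip) u \<longleftrightarrow> range u \<subseteq> V \<and> cauchy u"
proof -
  interpret Metric_space V "ip_dist V ip" by fact
  have dist: "ip_dist V ip (u m) (u n) = nrm (u m - u n)" if "range u \<subseteq> V" for m n
    using that by (auto simp: ip_dist_def nrm_def)
  show ?thesis
    unfolding MCauchy_def cauchy_def by (auto simp: dist; meson)
qed

end

context hilbert_space begin

lemma inner_product_on_subspace: "inner_product_on smul V ip"
  unfolding inner_product_on_def hermitian_form_on_def
proof (intro conjI ballI allI impI)
  fix x :: 'k assume "x \<noteq> 0"
  then show "0 < Re (ip x x)" using definite[of x] nonneg[of x] by (auto simp: less_le)
qed (auto simp: ip_simps intro: ip_cnj)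

text \<open>A Cauchy sequence in \<open>V\<close> converges in the whole space, and closedness
  returns its limit to \<open>V\<close>.\<close>

lemma hilbert_inner_product_on_closed:
  assumes V: "subspace V" and closed: "\<And>u l. range u \<subseteq> V \<Longrightarrow> tends u l \<Longrightarrow> l \<in> V"
  shows "hilbert_inner_product_on smul V ip"
proof -
  have M: "Metric_space V (ip_dist V ip)"
    by (rule Metric_space_ip_dist[OF vector_space_axioms V inner_product_on_subspace])
  have "\<exists>l. limitin (Metric_space.mtopology V (ip_dist V ip)) u l sequentially"
    if "Metric_space.MCauchy V (ip_dist V ip) u" for u
  proof -
    from that have u: "range u \<subseteq> V" "cauchy u" by (simp_all add: MCauchy_ip_dist[OF M])
    then obtain l where "tends u l" using complete by blast
    with u closed show ?thesis by (auto simp: limitin_ip_dist[OF M])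
  qed
  then show ?thesis
    unfolding hilbert_inner_product_on_def Metric_space.mcomplete_def[OF M]
    using inner_product_on_subspace by blast
qed

lemma closedin_ip_dist:
  assumes "\<And>u l. range u \<subseteq> V \<Longrightarrow> tends u l \<Longrightarrow> l \<in> V"
  shows "closedin (Metric_space.mtopology UNIV (ip_dist UNIV ip)) V"
proof -
  have M: "Metric_space UNIV (ip_dist UNIV ip)"
    by (rule Metric_space_ip_dist[OF vector_space_axioms subspace_UNIV inner_product_on_subspace])
  show ?thesis
    unfolding Metric_space.metric_closedin_iff_sequentially_closed[OF M]
    using assms by (auto simp: limitin_ip_dist[OF M])
qed

lemma equivalent_hilbert_space:
  assumes "semi_inner_product smul ip'"
    and le: "\<And>x. semi_inner_product.nrm ip' x \<le> K * nrm x"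
    and ge: "\<And>x. nrm x \<le> K * semi_inner_product.nrm ip' x"
  shows "hilbert_space smul ip'"
proof -
  interpret E: semi_inner_product smul ip' by fact
  \<comment> \<open>A positive replacement for \<open>K\<close>, so that it can be divided
    by.\<close>
  define C where "C = \<bar>K\<bar> + 1"
  have C: "C > 0" by (simp add: C_def)
  have le: "E.nrm x \<le> C * nrm x" and ge: "nrm x \<le> C * E.nrm x" for x
    unfolding C_def
    by (rule order_trans[OF le]; intro mult_right_mono; simp)
      (rule order_trans[OF ge]; intro mult_right_mono; simp)
  show ?thesis
  proof
    show "x = 0" if "Re (ip' x x) = 0" for x
      using ge[of x] that nrm_ge_0[of x] by (simp add: E.nrm_def nrm_eq_0 del: nrm_ge_0)
    fix u assume u: "E.cauchy u"
    have "cauchy u"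
      unfolding cauchy_def
    proof (intro allI impI)
      fix e :: real assume "e > 0"
      then have "e / C > 0" using C by simp
      then obtain M where "\<forall>m\<ge>M. \<forall>n\<ge>M. E.nrm (u m - u n) < e / C"
        using u unfolding E.cauchy_def by blast
      then have "\<forall>m\<ge>M. \<forall>n\<ge>M. C * E.nrm (u m - u n) < e"
        using C by (simp add: pos_less_divide_eq mult.commute)
      then show "\<exists>M. \<forall>m\<ge>M. \<forall>n\<ge>M. nrm (u m - u n) < e"
        using ge by (meson le_less_trans)
    qed
    then obtain l where l: "tends u l" using complete by blast
    have "E.tends u l"
    proof (rule E.tendsI)
      show "E.nrm (u n - l) \<le> C * nrm (u n - l)" for n by (rule le)
      show "(\<lambda>n. C * nrm (u n - l)) \<longlonglongrightarrow> 0"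
        using tendsto_mult_left[OF l[unfolded tends_def]] by simp
    qed
    then show "\<exists>l. E.tends u l" by blast
  qed
qed

section \<open>Schur's lemma\<close>

text \<open>Regular irreducibility enters only as \<open>kernel_trivial\<close>; the argument of
  this section is then pure Hilbert space theory.\<close>

context
  fixes G :: "('k \<Rightarrow> 'k) set"
  assumes bop_G: "T \<in> G \<Longrightarrow> bop T"
    and kernel_trivial: "bop D \<Longrightarrow> (\<And>T x. T \<in> G \<Longrightarrow> T (D x) = D (T x)) \<Longrightarrow>
      (\<forall>x. D x = 0) \<or> (\<forall>x. D x = 0 \<longrightarrow> x = 0)"
begin

lemma selfadjoint_semidefinite:
  assumes B: "bop B" and sa: "\<And>x y. ip (B x) y = ip x (B y)"
    and comm: "\<And>T x. T \<in> G \<Longrightarrow> T (B x) = B (T x)"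
  shows "(\<forall>x. 0 \<le> Re (ip (B x) x)) \<or> (\<forall>x. Re (ip (B x) x) \<le> 0)"
proof -
  obtain C where C: "0 < C" "\<And>x. nrm (B x) \<le> C * nrm x" using bop_bound[OF B] by blast
  \<comment> \<open>Scaling makes \<open>B\<close> a contraction, as \<open>ex_modulus\<close>
    demands, and keeps the sign of its quadratic form.\<close>
  define E where "E x = smul (of_real (1 / C)) (B x)" for x
  have E: "bop E" unfolding E_def by (rule bop_smult[OF B])
  have E_sa: "ip (E x) y = ip x (E y)" for x y by (simp add: E_def ip_simps sa)
  have E_contr: "nrm (E x) \<le> nrm x" for x
    using C by (simp add: E_def nrm_scale pos_divide_le_eq mult.commute norm_divide)
  have E_comm: "T (E x) = E (T x)" if "T \<in> G" for T x
    by (simp add: E_def bop_smul[OF bop_G[OF that]] comm[OF that])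
  obtain S where S: "bop S" "\<And>x. S (S x) = E (E x)" "\<And>x. 0 \<le> Re (ip (S x) x)"
    "\<And>T x. bop T \<Longrightarrow> (\<And>x. T (E x) = E (T x)) \<Longrightarrow> T (S x) = S (T x)"
    using ex_modulus[OF E E_sa E_contr] by blast
  have SG: "T (S x) = S (T x)" if "T \<in> G" for T x
    by (rule S(4)[OF bop_G[OF that] E_comm[OF that]])
  have SE: "E (S x) = S (E x)" for x by (rule S(4)[OF E refl])
  have "(\<forall>x. S x - E x = 0) \<or> (\<forall>x. S x - E x = 0 \<longrightarrow> x = 0)"
    by (rule kernel_trivial[OF bop_difference[OF S(1) E]])
      (simp add: bop_diff[OF bop_G] SG E_comm)
  then show ?thesis
  proof
    assume "\<forall>x. S x - E x = 0"
    then have "0 \<le> Re (ip (E x) x)" for x using S(3)[of x] by simp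
    then have "0 \<le> Re (ip (B x) x)" for x
      using C(1) by (simp add: E_def ip_simps zero_le_divide_iff)
    then show ?thesis by blast
  next
    assume inj: "\<forall>x. S x - E x = 0 \<longrightarrow> x = 0"
    \<comment> \<open>The squares cancel by \<open>S^2 = E^2\<close> and the mixed terms by
      \<open>SE\<close>, so the range of \<open>S + E\<close> lies in the kernel of
      \<open>S - E\<close>.\<close>
    have "S (S x + E x) - E (S x + E x) = 0" for x
      by (simp add: bop_plus[OF S(1)] bop_plus[OF E] S(2) SE)
    then have "S x + E x = 0" for x using inj by blast
    then have "S x = - E x" for x by (simp add: eq_neg_iff_add_eq_0)
    then have "Re (ip (E x) x) \<le> 0" for x using S(3)[of x] by (simp add: ip_simps)
    then have "Re (ip (B x) x) \<le> 0" for x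
      using C(1) by (simp add: E_def ip_simps divide_le_0_iff)
    then show ?thesis by blast
  qed
qed

text \<open>The scalar is the Rayleigh quotient \<open>s\<close> at any nonzero vector.
  Semidefiniteness of \<open>B - t\<close> for all real \<open>t\<close> forces every other Rayleigh
  quotient to equal \<open>s\<close>, and a self-adjoint operator with vanishing quadratic form is
  zero.\<close>

lemma selfadjoint_scalar:
  assumes B: "bop B" and sa: "\<And>x y. ip (B x) y = ip x (B y)"
    and comm: "\<And>T x. T \<in> G \<Longrightarrow> T (B x) = B (T x)"
  shows "\<exists>c. \<forall>x. B x = smul c x"
proof (cases "\<exists>x0::'k. x0 \<noteq> 0")
  case False
  then have "B x = smul 0 x" for x by (metis scale_zero_left)
  then show ?thesis by blast
next
  case True
  then obtain x0 :: 'k where x0: "x0 \<noteq> 0" by blast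
  define s where "s = Re (ip (B x0) x0) / (nrm x0)\<^sup>2"
  have p: "(nrm x0)\<^sup>2 > 0" using x0 by (simp add: nrm_eq_0)
  have s: "Re (ip (B x0) x0) = s * (nrm x0)\<^sup>2" using p by (simp add: s_def)
  have alt: "(\<forall>x. t * (nrm x)\<^sup>2 \<le> Re (ip (B x) x)) \<or> (\<forall>x. Re (ip (B x) x) \<le> t * (nrm x)\<^sup>2)" for t
  proof -
    define D where "D x = B x - smul (of_real t) x" for x
    have "(\<forall>x. 0 \<le> Re (ip (D x) x)) \<or> (\<forall>x. Re (ip (D x) x) \<le> 0)"
    proof (rule selfadjoint_semidefinite)
      show "bop D" unfolding D_def by (rule bop_difference[OF B bop_smult[OF bop_id]])
      show "ip (D x) y = ip x (D y)" for x y by (simp add: D_def ip_simps sa)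
      show "T (D x) = D (T x)" if "T \<in> G" for T x
        using bop_G[OF that] by (simp add: D_def bop_diff bop_smul comm[OF that])
    qed
    moreover have "Re (ip (D x) x) = Re (ip (B x) x) - t * (nrm x)\<^sup>2" for x
      by (simp add: D_def ip_simps nrm_power2)
    ultimately show ?thesis by simp
  qed
  \<comment> \<open>At \<open>x0\<close> the form of \<open>B - t\<close> is negative for
    \<open>s < t\<close>, which excludes the first alternative; \<open>lower\<close> is
    symmetric.\<close>
  have upper: "Re (ip (B x) x) \<le> t * (nrm x)\<^sup>2" if "s < t" for t x
    using alt[of t] mult_strict_right_mono[OF that p] s by (metis not_less)
  have lower: "t * (nrm x)\<^sup>2 \<le> Re (ip (B x) x)" if "t < s" for t x
    using alt[of t] mult_strict_right_mono[OF that p] s by (metis not_less)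
  have quad: "Re (ip (B x) x) = s * (nrm x)\<^sup>2" for x
  proof (cases "x = 0")
    case False
    then have q: "(nrm x)\<^sup>2 > 0" by (simp add: nrm_eq_0)
    have "Re (ip (B x) x) / (nrm x)\<^sup>2 \<le> s"
      by (rule dense_ge) (simp add: pos_divide_le_eq[OF q] upper)
    moreover have "s \<le> Re (ip (B x) x) / (nrm x)\<^sup>2"
      by (rule dense_le) (simp add: pos_le_divide_eq[OF q] lower)
    ultimately have "Re (ip (B x) x) / (nrm x)\<^sup>2 = s" by (rule antisym)
    then show ?thesis using q by (simp add: field_simps)
  qed (simp add: bop_zero[OF B])
  define E where "E x = B x - smul (of_real s) x" for x
  have E: "bop E" unfolding E_def by (rule bop_difference[OF B bop_smult[OF bop_id]])
  have E_sa: "ip (E x) y = ip x (E y)" for x y by (simp add: E_def ip_simps sa)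
  have E0: "Re (ip (E x) x) = 0" for x
    by (simp add: E_def ip_simps quad nrm_power2)
  have "E x = 0" for x
  proof (rule definite)
    \<comment> \<open>Polarisation: for the vectors \<open>x\<close> and \<open>E x\<close> both
      cross terms equal the squared norm of \<open>E x\<close>.\<close>
    have "Re (ip (E (x + E x)) (x + E x)) = 0" by (rule E0)
    then have "Re (ip (E x) (E x)) + Re (ip (E (E x)) x) = 0"
      by (simp only: bop_plus[OF E] ip_add_left ip_add_right plus_complex.sel E0)
    then show "Re (ip (E x) (E x)) = 0" by (simp add: E_sa[of "E x" x])
  qed
  then show ?thesis unfolding E_def by (metis eq_iff_diff_eq_0)
qed

text \<open>Cartesian decomposition: \<open>A + A'\<close> and the imaginary unit times
  \<open>A - A'\<close> are self-adjoint. They commute with \<open>G\<close> because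
  \<open>G\<close> is closed under adjoints, so both are scalars.\<close>

theorem schur:
  assumes adj: "\<And>U. U \<in> G \<Longrightarrow> \<exists>U'\<in>G. \<forall>x y. ip (U x) y = ip x (U' y)"
    and A: "bop A" and comm: "\<And>T x. T \<in> G \<Longrightarrow> T (A x) = A (T x)"
  shows "\<exists>c. \<forall>x. A x = smul c x"
proof -
  obtain A' where A': "bop A'" "\<And>x y. ip (A x) y = ip x (A' y)" using ex_adjoint[OF A] by blast
  have A'_left: "ip (A' x) y = ip x (A y)" for x y
    using A'(2)[of y x] ip_cnj[of "A' x" y] ip_cnj[of x "A y"] by (metis complex_cnj_cnj)
  have A'_comm: "T (A' x) = A' (T x)" if T: "T \<in> G" for T x
  proof (rule ip_eqI)
    fix y
    obtain V where V: "V \<in> G" "\<And>u v. ip (T u) v = ip u (V v)" using adj[OF T] by blast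
    have V_left: "ip (V u) v = ip u (T v)" for u v
      using V(2)[of v u] ip_cnj[of "V u" v] ip_cnj[of u "T v"] by (metis complex_cnj_cnj)
    show "ip y (T (A' x)) = ip y (A' (T x))"
      by (simp add: comm[OF V(1)] flip: A'(2) V_left)
  qed
  have "\<exists>c. \<forall>x. A x + A' x = smul c x"
    by (rule selfadjoint_scalar[OF bop_sum[OF A A'(1)]])
      (simp_all add: ip_simps A'(2) A'_left bop_plus[OF bop_G] comm A'_comm add.commute)
  then obtain c where c: "\<And>x. A x + A' x = smul c x" by blast
  have "\<exists>d. \<forall>x. smul \<i> (A x - A' x) = smul d x"
    by (rule selfadjoint_scalar[OF bop_smult[OF bop_difference[OF A A'(1)]]])
      (simp_all add: ip_simps A'(2) A'_left bop_diff[OF bop_G] bop_smul[OF bop_G] comm A'_comm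
        algebra_simps)
  then obtain d where d: "\<And>x. smul \<i> (A x - A' x) = smul d x" by blast
  \<comment> \<open>Multiplying the equation for \<open>d\<close> by the imaginary unit gives
    \<open>A - A' = - i d\<close>; adding \<open>A + A' = c\<close> yields
    \<open>2 A\<close>.\<close>
  have "A x = smul (1/2 * (c - \<i> * d)) x" for x
  proof -
    have "smul \<i> (smul \<i> (A x - A' x)) = - (A x - A' x)" by (simp only: scale_scale) simp
    then have "A x - A' x = - smul \<i> (smul d x)" by (simp add: d)
    moreover have "smul 2 (A x) = A x + A x" using scale_left_distrib[of 1 1 "A x"] by simp
    ultimately have "smul 2 (A x) = smul c x - smul \<i> (smul d x)"
      using c[of x] by (simp add: algebra_simps)
    then have "smul (1/2) (smul 2 (A x)) = smul (1/2) (smul (c - \<i> * d) x)"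
      by (simp add: scale_left_diff_distrib)
    then show ?thesis by simp
  qed
  then show ?thesis by blast
qed

end

end

section \<open>Krein spaces\<close>

lemma hilbert_space_of_inner_product:
  assumes vs: "vector_space smul" and "hilbert_inner_product_on smul UNIV ip"
  shows "hilbert_space smul ip"
proof -
  interpret vector_space smul by (rule vs)
  have ip: "inner_product_on smul UNIV ip"
    and complete: "Metric_space.mcomplete UNIV (ip_dist UNIV ip)"
    using assms(2) unfolding hilbert_inner_product_on_def by blast+
  have M: "Metric_space UNIV (ip_dist UNIV ip)"
    by (rule Metric_space_ip_dist[OF vs subspace_UNIV ip])
  have herm: "hermitian_form_on smul UNIV ip" using ip unfolding inner_product_on_def by blast
  have pos: "0 < Re (ip x x)" if "x \<noteq> 0" for x
    using ip that unfolding inner_product_on_def by blast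
  have "ip (smul 0 0) 0 = 0 * ip 0 0" using herm unfolding hermitian_form_on_def by blast
  then have "ip 0 0 = 0" by simp
  then have nonneg: "0 \<le> Re (ip x x)" for x using pos[of x] by (cases "x = 0") simp_all
  interpret semi_inner_product smul ip
    by (intro semi_inner_product.intro semi_inner_product_axioms.intro vs herm nonneg)
  show ?thesis
  proof
    show "x = 0" if "Re (ip x x) = 0" for x using pos[of x] that by (cases "x = 0") simp_all
    fix u assume "cauchy u"
    then have "Metric_space.MCauchy UNIV (ip_dist UNIV ip) u"
      by (simp add: MCauchy_ip_dist[OF M])
    then obtain l where "limitin (Metric_space.mtopology UNIV (ip_dist UNIV ip)) u l sequentially"
      using complete unfolding Metric_space.mcomplete_def[OF M] by blast
    then show "\<exists>l. tends u l" using limitin_ip_dist[OF M, of u l] by blast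
  qed
qed

text \<open>Both norms arise from the same form, so each is dominated by the other through the
  Cauchy--Schwarz inequality as soon as \<open>g\<close> is bounded for the norm of \<open>J\<close>.\<close>

lemma fundamental_symmetry_equivalent:
  assumes herm: "hermitian_form_on smul UNIV form"
    and "hilbert_space smul (\<lambda>x y. form (J x) y)" and J: "\<And>x. J (J x) = x"
    and "semi_inner_product smul (\<lambda>x y. form (g x) y)" and g: "\<And>x. g (g x) = x"
    and bound: "\<And>x. semi_inner_product.nrm (\<lambda>x y. form (J x) y) (g x) \<le>
      C * semi_inner_product.nrm (\<lambda>x y. form (J x) y) x"
  obtains K where "0 \<le> K"
    "\<And>x. semi_inner_product.nrm (\<lambda>x y. form (g x) y) x \<le> K * semi_inner_product.nrm (\<lambda>x y. form (J x) y) x"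
    "\<And>x. semi_inner_product.nrm (\<lambda>x y. form (J x) y) x \<le> K * semi_inner_product.nrm (\<lambda>x y. form (g x) y) x"
proof -
  interpret J: hilbert_space smul "\<lambda>x y. form (J x) y" by fact
  interpret g: semi_inner_product smul "\<lambda>x y. form (g x) y" by fact
  have sym: "Re (form x y) = Re (form y x)" for x y
    using herm unfolding hermitian_form_on_def by (metis UNIV_I cnj.sel(1))
  have J_iso: "J.nrm (J x) = J.nrm x" for x
    by (simp add: J.nrm_def J sym[of x "J x"])
  have g_iso: "g.nrm (g x) = g.nrm x" for x
    by (simp add: g.nrm_def g sym[of x "g x"])
  \<comment> \<open>From \<open>[g x, x] = [J (J (g x)), x]\<close>, Cauchy-Schwarz for
    \<open>J\<close> bounds the squared \<open>g\<close>-norm by \<open>\<bar>C\<bar>\<close> times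
    the squared \<open>J\<close>-norm.\<close>
  define K where "K = sqrt \<bar>C\<bar>"
  have le: "g.nrm x \<le> K * J.nrm x" for x
  proof (rule power2_le_imp_le)
    have "(g.nrm x)\<^sup>2 = Re (form (J (J (g x))) x)" by (simp add: g.nrm_power2 J)
    also have "\<dots> \<le> J.nrm (g x) * J.nrm x"
      using J.cauchy_schwarz[of "J (g x)" x] by (simp add: J_iso)
    also have "\<dots> \<le> \<bar>C\<bar> * J.nrm x * J.nrm x"
      using mult_right_mono[OF abs_ge_self[of C] J.nrm_ge_0[of x]] bound[of x]
      by (intro mult_right_mono J.nrm_ge_0) linarith
    also have "\<dots> = (K * J.nrm x)\<^sup>2"
      by (simp add: K_def power_mult_distrib power2_eq_square[of "J.nrm x"])
    finally show "(g.nrm x)\<^sup>2 \<le> (K * J.nrm x)\<^sup>2" .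
  qed (simp add: K_def)
  \<comment> \<open>The roles are exchanged: \<open>[J x, x] = [g (g (J x)), x]\<close>. The factor
    \<open>g.nrm (J x)\<close> is controlled by \<open>le\<close>, so the same \<open>K\<close>
    serves.\<close>
  have ge: "J.nrm x \<le> K * g.nrm x" for x
  proof (cases "J.nrm x = 0")
    case False
    have "J.nrm x * J.nrm x = Re (form (g (g (J x))) x)"
      using J.nrm_power2[of x] by (simp add: g power2_eq_square)
    also have "\<dots> \<le> g.nrm (J x) * g.nrm x"
      using g.cauchy_schwarz[of "g (J x)" x] by (simp add: g_iso)
    also have "\<dots> \<le> K * J.nrm x * g.nrm x"
      using le[of "J x"] by (intro mult_right_mono) (simp_all add: J_iso)
    also have "\<dots> = J.nrm x * (K * g.nrm x)" by simp
    finally show ?thesis using False J.nrm_ge_0[of x] by (simp del: J.nrm_ge_0)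
  qed (simp add: K_def)
  have "0 \<le> K" by (simp add: K_def)
  then show ?thesis using le ge by (rule that)
qed

section \<open>Kernels of commuting operators as regular subspaces\<close>

lemma hermitian_form_on_subset:
  assumes "hermitian_form_on smul V f" "W \<subseteq> V"
  shows "hermitian_form_on smul W f"
  unfolding hermitian_form_on_def
proof (intro conjI ballI allI)
  fix x y z c
  assume "x \<in> W" "y \<in> W"
  then have V: "x \<in> V" "y \<in> V" using assms(2) by blast+
  show "f (smul c x) y = c * f x y" using assms(1) V unfolding hermitian_form_on_def by blast
  show "f y x = cnj (f x y)" using assms(1) V unfolding hermitian_form_on_def by blast
  assume "z \<in> W"
  then have "z \<in> V" using assms(2) by blast
  then show "f (x + y) z = f x z + f y z" using assms(1) V unfolding hermitian_form_on_def by blast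
qed

text \<open>The kernel is closed in the norm of \<open>g\<close>, whereas
  \<open>krein_topology\<close> is built from another, arbitrarily chosen symmetry;
  \<open>top\<close> bridges the two.\<close>

lemma (in hilbert_space) regular_subspace_kernel:
  assumes krein: "krein_space smul form"
    and ip: "ip = (\<lambda>x y. form (g x) y)"
    and g: "\<And>x y. g (x + y) = g x + g y" "\<And>c x. g (smul c x) = smul c (g x)" "\<And>x. g (g x) = x"
    and top: "\<And>V. (\<And>u l. range u \<subseteq> V \<Longrightarrow> tends u l \<Longrightarrow> l \<in> V) \<Longrightarrow> closedin (krein_topology smul form) V"
    and D: "bop D" and comm: "\<And>x. g (D x) = D (g x)"
  shows "regular_subspace smul form {x. D x = 0}"
proof -
  let ?S = "{x. D x = 0}"
  have sub: "subspace ?S"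
    by (rule subspaceI) (simp_all add: bop_zero[OF D] bop_plus[OF D] bop_smul[OF D])
  have closed: "l \<in> ?S" if u: "range u \<subseteq> ?S" "tends u l" for u l
  proof -
    have "D (u n) = 0" for n using u(1) by blast
    then have "tends (\<lambda>_. 0) (D l)" using tends_bop[OF D u(2)] by simp
    then show ?thesis using tends_unique[OF _ tends_const] by blast
  qed
  have "g 0 = 0" using g(2)[of 0 0] by simp
  then have inv: "g x \<in> ?S" if "x \<in> ?S" for x using that comm[of x] by simp
  have "fundamental_symmetry_on smul ?S form g"
    unfolding fundamental_symmetry_on_def
  proof (intro conjI ballI allI)
    show "hilbert_inner_product_on smul ?S (\<lambda>x y. form (g x) y)"
      using hilbert_inner_product_on_closed[OF sub closed] by (simp only: ip)
  qed (simp_all only: g, rule inv)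
  moreover have "hermitian_form_on smul UNIV form" using krein unfolding krein_space_on_def by blast
  then have "hermitian_form_on smul ?S form" by (rule hermitian_form_on_subset) simp
  ultimately have "krein_space_on smul ?S form"
    unfolding krein_space_on_def using vector_space_axioms sub by blast
  then show ?thesis
    unfolding regular_subspace_def by (intro conjI sub top) (rule closed)
qed

theorem lemma2p14:
  fixes smul :: "complex \<Rightarrow> 'k::ab_group_add \<Rightarrow> 'k"
    and form :: "'k \<Rightarrow> 'k \<Rightarrow> complex"
    and G :: "('k \<Rightarrow> 'k) set"
    and A :: "'k \<Rightarrow> 'k"
  assumes "krein_space smul form"
    and "unitary_operator_group smul form G"
    and "fundamental_action form G"
    and "regularly_irreducible smul form G"
    and "bounded_operator smul form A"
    and "\<forall>T\<in>G. T \<circ> A = A \<circ> T"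
  shows "\<exists>c. \<forall>x. A x = smul c x"
proof -
  \<comment> \<open>The symmetry hidden in \<open>krein_ip\<close>, so that \<open>J.nrm\<close> is
    exactly the norm in which boundedness is stated.\<close>
  define J where "J = (SOME J. fundamental_symmetry_on smul UNIV form J)"
  have vs: "vector_space smul" and herm: "hermitian_form_on smul UNIV form"
    using assms(1) unfolding krein_space_on_def by blast+
  have "\<exists>J. fundamental_symmetry_on smul UNIV form J"
    using assms(1) unfolding krein_space_on_def by blast
  then have "fundamental_symmetry_on smul UNIV form J"
    unfolding J_def by (rule someI_ex)
  then have JJ: "\<And>x. J (J x) = x" and hilb: "hilbert_inner_product_on smul UNIV (\<lambda>x y. form (J x) y)"
    unfolding fundamental_symmetry_on_def by blast+
  interpret J: hilbert_space smul "\<lambda>x y. form (J x) y"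
    by (rule hilbert_space_of_inner_product[OF vs hilb])
  have krein_ip: "krein_ip smul form = (\<lambda>x y. form (J x) y)"
    by (simp add: fun_eq_iff krein_ip_def J_def)
  have krein_norm: "krein_norm smul form = J.nrm"
    by (simp add: fun_eq_iff krein_norm_def krein_ip J.nrm_def)
  have bounded: "J.bop T" if T: "bounded_operator smul form T" for T
  proof -
    interpret Vector_Spaces.linear smul smul T using T unfolding bounded_operator_def by blast
    obtain C where "\<And>x. J.nrm (T x) \<le> C * J.nrm x"
      using T unfolding bounded_operator_def krein_norm by blast
    then show ?thesis by (rule J.bopI[OF add scale])
  qed
  have unitary: "bounded_operator smul form U" "bij U" "form (U x) y = form x (inv_into UNIV U y)" if "U \<in> G" for U x y
    using that assms(2) unfolding unitary_operator_group_def krein_unitary_def krein_adjoint_def by blast+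

  obtain g where gG: "g \<in> G" and "krein_adjoint form g g" "g \<circ> g = id" "krein_positive form g"
    using assms(3) unfolding fundamental_action_def by blast
  then have g_adj: "\<And>x y. form (g x) y = form x (g y)"
    and gg: "\<And>x. g (g x) = x" and g_pos: "\<And>x. form (g x) x \<in> \<real>\<^sub>\<ge>\<^sub>0"
    unfolding krein_adjoint_def krein_positive_def fun_eq_iff by simp_all
  have g_bop: "J.bop g" by (rule bounded[OF unitary(1)[OF gG]])
  have semi: "semi_inner_product smul (\<lambda>x y. form (g x) y)"
  proof (intro semi_inner_product.intro semi_inner_product_axioms.intro vs)
    show "hermitian_form_on smul UNIV (\<lambda>x y. form (g x) y)"
      unfolding hermitian_form_on_def
    proof (intro conjI ballI allI)
      show "form (g (x + y)) z = form (g x) z + form (g y) z" for x y z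
        using herm unfolding hermitian_form_on_def J.bop_plus[OF g_bop] by blast
      show "form (g (smul c x)) y = c * form (g x) y" for c x y
        using herm unfolding hermitian_form_on_def J.bop_smul[OF g_bop] by blast
      have "form y (g x) = cnj (form (g x) y)" for x y
        using herm unfolding hermitian_form_on_def by blast
      then show "form (g y) x = cnj (form (g x) y)" for x y by (simp only: g_adj[of y])
    qed
    show "0 \<le> Re (form (g x) x)" for x
      using g_pos[of x] by (auto simp: nonneg_Reals_def)
  qed
  \<comment> \<open>As a unitary in \<open>G\<close>, \<open>g\<close> is bounded in the norm of
    \<open>J\<close>, which makes the two norms equivalent.\<close>
  obtain C where "\<And>x. J.nrm (g x) \<le> C * J.nrm x" using J.bop_bound[OF g_bop] by blast
  then obtain K where K: "0 \<le> K" and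
    le: "\<And>x. semi_inner_product.nrm (\<lambda>x y. form (g x) y) x \<le> K * J.nrm x" and
    ge: "\<And>x. J.nrm x \<le> K * semi_inner_product.nrm (\<lambda>x y. form (g x) y) x"
    by (rule fundamental_symmetry_equivalent[OF herm J.hilbert_space_axioms JJ semi gg]) (rule that)
  interpret g: hilbert_space smul "\<lambda>x y. form (g x) y"
    by (rule J.equivalent_hilbert_space[OF semi le ge])
  have bop: "g.bop T" if T: "bounded_operator smul form T" for T
  proof -
    note bT = bounded[OF T]
    obtain C where C: "0 < C" "\<And>x. J.nrm (T x) \<le> C * J.nrm x" using J.bop_bound[OF bT] by blast
    have "g.nrm (T x) \<le> K * C * K * g.nrm x" for x
    proof -
      have "g.nrm (T x) \<le> K * J.nrm (T x)" by (rule le)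
      also have "\<dots> \<le> K * (C * J.nrm x)" by (rule mult_left_mono[OF C(2) K])
      also have "\<dots> \<le> K * (C * (K * g.nrm x))"
        using mult_left_mono[OF mult_left_mono[OF ge[of x], of C] K] C(1) by simp
      finally show ?thesis by (simp only: mult.assoc)
    qed
    then show ?thesis by (rule g.bopI[OF J.bop_plus[OF bT] J.bop_smul[OF bT]])
  qed
  have closed: "closedin (krein_topology smul form) V"
    if V: "\<And>u l. range u \<subseteq> V \<Longrightarrow> g.tends u l \<Longrightarrow> l \<in> V" for V
    unfolding krein_topology_def krein_ip
  proof (rule J.closedin_ip_dist)
    \<comment> \<open>Convergence for \<open>J\<close> implies convergence for
      \<open>g\<close>.\<close>
    fix u l assume u: "range u \<subseteq> V" "J.tends u l"
    have "g.tends u l"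
    proof (rule g.tendsI)
      show "(\<lambda>n. K * J.nrm (u n - l)) \<longlonglongrightarrow> 0"
        using tendsto_mult_left[OF u(2)[unfolded J.tends_def]] by simp
    qed (rule le)
    with V u show "l \<in> V" by blast
  qed
  let ?G = "\<lparr>carrier = G, monoid.mult = (\<circ>), one = id\<rparr>"
  have grp: "group ?G" using assms(2) unfolding unitary_operator_group_def by blast
  have comp: "S \<circ> T \<in> G" if "S \<in> G" "T \<in> G" for S T
    using monoid.m_closed[OF group.is_monoid[OF grp], of S T] that by simp
  \<comment> \<open>The abstract group inverse is a left inverse under composition, hence the
    inverse function of the bijection \<open>U\<close>.\<close>
  have inverse: "inv_into UNIV U \<in> G" if U: "U \<in> G" for U
  proof -
    obtain W where W: "W \<in> G" "W \<circ> U = id"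
      using group.l_inv_ex[OF grp, of U] U by auto
    have "inv_into UNIV U x = W x" for x
      using fun_cong[OF W(2), of "inv_into UNIV U x"] surj_f_inv_f[OF bij_is_surj[OF unitary(2)[OF U]], of x]
      by simp
    then have "inv_into UNIV U = W" by (rule ext)
    then show ?thesis using W(1) by simp
  qed
  show ?thesis
  proof (rule g.schur[where G = G])
    show "g.bop T" if "T \<in> G" for T by (rule bop[OF unitary(1)[OF that]])
    show "(\<forall>x. D x = 0) \<or> (\<forall>x. D x = 0 \<longrightarrow> x = 0)"
      if D: "g.bop D" "\<And>T x. T \<in> G \<Longrightarrow> T (D x) = D (T x)" for D
    proof -
      have g_comm: "g (D x) = D (g x)" for x by (rule D(2)[OF gG])
      have "regular_subspace smul form {x. D x = 0}"
      proof (rule g.regular_subspace_kernel[where g = g])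
        show "closedin (krein_topology smul form) V"
          if "\<And>u l. range u \<subseteq> V \<Longrightarrow> g.tends u l \<Longrightarrow> l \<in> V" for V
          using that by (rule closed)
      qed (fact assms(1) refl J.bop_plus[OF g_bop] J.bop_smul[OF g_bop] gg D(1) g_comm)+
      moreover have "\<forall>T\<in>G. T ` {x. D x = 0} \<subseteq> {x. D x = 0}"
      proof (intro ballI image_subsetI)
        fix T x assume T: "T \<in> G" and "x \<in> {x. D x = 0}"
        then have "D x = 0" by (simp only: mem_Collect_eq)
        then have "D (T x) = T 0" by (simp only: D(2)[OF T, of x, symmetric])
        also have "T 0 = 0" by (rule J.bop_zero[OF bounded[OF unitary(1)[OF T]]])
        finally show "T x \<in> {x. D x = 0}" by (simp only: mem_Collect_eq)
      qed
      ultimately have "{x. D x = 0} = {0} \<or> {x. D x = 0} = UNIV"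
        using spec[OF assms(4)[unfolded regularly_irreducible_def], of "{x. D x = 0}"] by (simp only: simp_thms)
      then show ?thesis
      proof
        assume "{x. D x = 0} = {0}"
        then show ?thesis by (simp add: set_eq_iff)
      next
        assume "{x. D x = 0} = UNIV"
        then show ?thesis by (simp add: set_eq_iff)
      qed
    qed
    show "\<exists>U'\<in>G. \<forall>x y. form (g (U x)) y = form (g x) (U' y)" if U: "U \<in> G" for U
    proof
      \<comment> \<open>The Hilbert adjoint of \<open>U\<close> is \<open>g U^(-1) g\<close>: moving
        \<open>g\<close> and then \<open>U\<close> across the form gives
        \<open>[g (U x), y] = [x, U^(-1) (g y)]\<close>, and inserting \<open>g\<close> on both
        sides leaves the form unchanged.\<close>
      show "g \<circ> (inv_into UNIV U \<circ> g) \<in> G" by (rule comp[OF gG comp[OF inverse[OF U] gG]])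
      show "\<forall>x y. form (g (U x)) y = form (g x) ((g \<circ> (inv_into UNIV U \<circ> g)) y)"
        by (simp add: g_adj unitary(3)[OF U] gg)
    qed
    show "g.bop A" by (rule bop[OF assms(5)])
    show "T (A x) = A (T x)" if "T \<in> G" for T x
      using fun_cong[OF bspec[OF assms(6) that], of x] by simp
  qed
qed
end
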